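(* Let $G$ be a separable topological group whose topology is given by a right-invariant metric $d_R^G$, and write $\|t\|:=d_R^G(1_G,t)$. Let $\mathcal{D}$ be a topology on $G$ refining the topology of $d_R^G$ and having the following properties: (i) $\mathcal{D}$ is shift-invariant: $x\mathcal{D}=\mathcal{D}$ for all $x\in G$; (ii) (localization property) $H\setminus\mathrm{int}_{\mathcal{D}}(H)\in\mathcal{B}_0(\mathcal{D})$ for all $H\in\mathcal{B}(\mathcal{D})$; (iii) (left Kemperman property) for every $U\in\mathcal{D}$ with $1_G\in U$ there is $\delta=\delta_U>0$ with $U\cap(tU)\in\mathcal{B}_+(\mathcal{D})$ for all $\|t\|<\delta$; (iv) $\mathcal{D}$ is a strong generalized Gandy-Harrington topology: modulo $\mathcal{B}_0(\mathcal{D})$ each set in $\mathcal{B}(\mathcal{D})$ is analytic under $d_R^G$, so that $(G,\mathcal{D})$ is a Baire space. Then, for every sequence $z_n\to1_G$ (convergence in $d_R^G$) and every $A\in\mathcal{B}_+(\mathcal{D})$, for quasi all $a\in A$ (i.e. for all $a\in A$ off a set in $\mathcal{B}_0(\mathcal{D})$) there is an infinite set $\mathbb{M}_a\subseteq\mathbb{N}$ such that $$\{z_ma:m\in\mathbb{M}_a\}\subseteq A.$$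
   Context: For a topology $\tau$ on $G$: $\mathcal{B}(\tau)$ is the family of sets with the Baire property in $\tau$, $\mathcal{B}_0(\tau)$ the $\tau$-meagre sets, $\mathcal{B}_+(\tau):=\mathcal{B}(\tau)\setminus\mathcal{B}_0(\tau)$, $\mathrm{int}_\tau$ the $\tau$-interior. $x\mathcal{D}:=\{xV:V\in\mathcal{D}\}$. "$A$ is analytic under $d_R^G$ modulo $\mathcal{B}_0(\mathcal{D})$" means that there is a set $A'$, analytic under $d_R^G$, with $A\triangle A'\in\mathcal{B}_0(\mathcal{D})$; analytic means obtained by the Souslin operation from closed sets of the $d_R^G$-topology: $A'=\bigcup_{i\in\omega^\omega}\bigcap_nF(i_1,\dots,i_n)$ with all $F(i_1,\dots,i_n)$ closed (in a Polish space, equivalently, empty or a continuous image of $\omega^\omega$). *)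

theory Defs
  imports "HOL-Analysis.Analysis" "HOL-Algebra.Coset"
begin

definition nowhere_dense_in :: "'a topology \<Rightarrow> 'a set \<Rightarrow> bool" where
  "nowhere_dense_in X S \<longleftrightarrow> S \<subseteq> topspace X \<and> X interior_of (X closure_of S) = {}"

definition meagre_sets :: "'a topology \<Rightarrow> 'a set set" where
  "meagre_sets X = {S. \<exists>N :: nat \<Rightarrow> 'a set. (\<forall>n. nowhere_dense_in X (N n)) \<and> S = (\<Union>n. N n)}"

definition baire_property_sets :: "'a topology \<Rightarrow> 'a set set" where
  "baire_property_sets X = {S. \<exists>U N. openin X U \<and> N \<in> meagre_sets X \<and> S = sym_diff U N}"

definition nonmeagre_baire_sets :: "'a topology \<Rightarrow> 'a set set" where
  "nonmeagre_baire_sets X = baire_property_sets X - meagre_sets X"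

definition baire_space :: "'a topology \<Rightarrow> bool" where
  "baire_space X \<longleftrightarrow>
    (\<forall>U :: nat \<Rightarrow> 'a set. (\<forall>n. openin X (U n) \<and> X closure_of (U n) = topspace X)
        \<longrightarrow> X closure_of (\<Inter>n. U n) = topspace X)"

definition separable_topology :: "'a topology \<Rightarrow> bool" where
  "separable_topology X \<longleftrightarrow> (\<exists>C. countable C \<and> C \<subseteq> topspace X \<and> X closure_of C = topspace X)"

text \<open>
  The finite sequence of the first \<open>n\<close> terms of \<open>i\<close> is the list \<open>map i [0..<n]\<close>;
  only nonempty initial segments occur in the intersection.
\<close>

definition analytic_in :: "'a topology \<Rightarrow> 'a set \<Rightarrow> bool" where
  "analytic_in X A \<longleftrightarrow>
    (\<exists>F :: nat list \<Rightarrow> 'a set. (\<forall>s. closedin X (F s)) \<and>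
        A = (\<Union>i :: nat \<Rightarrow> nat. \<Inter>n\<in>{1..}. F (map i [0..<n])))"

definition topological_group :: "('a, 'b) monoid_scheme \<Rightarrow> 'a topology \<Rightarrow> bool" where
  "topological_group G X \<longleftrightarrow> group G \<and> topspace X = carrier G \<and>
    continuous_map (prod_topology X X) X (\<lambda>(x, y). x \<otimes>\<^bsub>G\<^esub> y) \<and>
    continuous_map X X (\<lambda>x. inv\<^bsub>G\<^esub> x)"

definition right_invariant :: "('a, 'b) monoid_scheme \<Rightarrow> ('a \<Rightarrow> 'a \<Rightarrow> real) \<Rightarrow> bool" where
  "right_invariant G d \<longleftrightarrow>
    (\<forall>x\<in>carrier G. \<forall>y\<in>carrier G. \<forall>g\<in>carrier G. d (x \<otimes>\<^bsub>G\<^esub> g) (y \<otimes>\<^bsub>G\<^esub> g) = d x y)"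

definition refines_topology :: "'a topology \<Rightarrow> 'a topology \<Rightarrow> bool" where
  "refines_topology D X \<longleftrightarrow> topspace D = topspace X \<and> (\<forall>U. openin X U \<longrightarrow> openin D U)"

definition shift_invariant :: "('a, 'b) monoid_scheme \<Rightarrow> 'a topology \<Rightarrow> bool" where
  "shift_invariant G D \<longleftrightarrow>
    (\<forall>x\<in>carrier G. (\<lambda>V. x <#\<^bsub>G\<^esub> V) ` {V. openin D V} = {V. openin D V})"

definition localization_property :: "'a topology \<Rightarrow> bool" where
  "localization_property D \<longleftrightarrow>
    (\<forall>H\<in>baire_property_sets D. H - D interior_of H \<in> meagre_sets D)"

definition left_kemperman ::
    "('a, 'b) monoid_scheme \<Rightarrow> ('a \<Rightarrow> 'a \<Rightarrow> real) \<Rightarrow> 'a topology \<Rightarrow> bool" where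
  "left_kemperman G d D \<longleftrightarrow>
    (\<forall>U. openin D U \<and> \<one>\<^bsub>G\<^esub> \<in> U \<longrightarrow>
      (\<exists>\<delta>>0. \<forall>t\<in>carrier G. d \<one>\<^bsub>G\<^esub> t < \<delta> \<longrightarrow> U \<inter> (t <#\<^bsub>G\<^esub> U) \<in> nonmeagre_baire_sets D))"

text \<open>
  For a shift-invariant topology with the left Kemperman property the conjunct
  \<open>baire_space D\<close> is automatic: taking \<open>t = \<one>\<close> there shows that nonempty open sets are nonmeagre.
\<close>

definition strong_gandy_harrington :: "'a topology \<Rightarrow> 'a topology \<Rightarrow> bool" where
  "strong_gandy_harrington X D \<longleftrightarrow>
    (\<forall>H\<in>baire_property_sets D. \<exists>A'. analytic_in X A' \<and> sym_diff H A' \<in> meagre_sets D) \<and>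
    baire_space D"

end

theory Submission
  imports Defs
begin

text \<open>
  By localization \<open>A\<close> may be replaced by its \<open>D\<close>-interior \<open>O\<close>. If a nonempty open \<open>U\<close> contains \<open>u\<close>, the
  Kemperman property of the neighbourhood \<open>u\<^sup>-\<^sup>1U\<close> of the identity, applied to the conjugates
  \<open>u\<^sup>-\<^sup>1z\<^sub>mu \<rightarrow> 1\<close>, shows that \<open>U\<close> meets \<open>z\<^sub>mU\<close> for all large \<open>m\<close>. Hence the open set of points that
  some \<open>z\<^sub>m\<close> with \<open>m \<ge> k\<close> maps into \<open>O\<close> is dense in \<open>O\<close>, so its complement in \<open>O\<close> is nowhere dense;
  the exceptional set is the union of these complements over \<open>k\<close> and of \<open>A - O\<close>.
\<close>

lemma Union_nowhere_dense_meagre: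
  assumes "countable F" "\<And>S. S \<in> F \<Longrightarrow> nowhere_dense_in X S"
  shows "\<Union>F \<in> meagre_sets X"
proof -
  \<comment> \<open>Meagreness is defined through a sequence, and \<open>F\<close> may be empty.
    Adding the empty set leaves the union unchanged and makes the family nonempty, so that
    \<open>from_nat_into\<close> runs through exactly its members.\<close>
  let ?F = "insert {} F"
  have "nowhere_dense_in X {}"
    by (simp add: nowhere_dense_in_def)
  then have "\<forall>n. nowhere_dense_in X (from_nat_into ?F n)"
    using assms(2) from_nat_into[of ?F] by (metis insertE insert_not_empty)
  moreover have "range (from_nat_into ?F) = ?F"
    using assms(1) by (intro range_from_nat_into) auto
  then have "\<Union>F = (\<Union>n. from_nat_into ?F n)"
    by simp
  ultimately show ?thesis
    unfolding meagre_sets_def by blast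
qed

lemma meagre_sets_Un_nowhere_dense:
  assumes "M \<in> meagre_sets X" "\<And>n::nat. nowhere_dense_in X (P n)"
  shows "M \<union> (\<Union>n. P n) \<in> meagre_sets X"
proof -
  obtain N where N: "\<And>n::nat. nowhere_dense_in X (N n)" "M = (\<Union>n. N n)"
    using assms(1) unfolding meagre_sets_def by blast
  have "\<Union>(range N \<union> range P) \<in> meagre_sets X"
    by (rule Union_nowhere_dense_meagre) (use N(1) assms(2) in auto)
  then show ?thesis
    by (simp add: N(2))
qed

text \<open>The empty union is meagre. This is all that is kept of the Kemperman property: the
  intersection contains a point.\<close>

lemma nonmeagre_imp_nonempty: "S \<in> nonmeagre_baire_sets X \<Longrightarrow> S \<noteq> {}"
  using Union_nowhere_dense_meagre[of "{}" X] by (auto simp: nonmeagre_baire_sets_def)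

text \<open>A nonempty open subset of the closure of \<open>W - V\<close> meets
  \<open>W - V\<close>. If the interior \<open>?I\<close> of that closure were nonempty, then so
  would be \<open>?I \<inter> W\<close>, which by hypothesis meets \<open>V\<close>; now
  \<open>?I \<inter> W \<inter> V\<close> would have to meet \<open>W - V\<close>, which is
  absurd.\<close>

lemma nowhere_dense_in_diff_open:
  assumes "openin X V" "openin X W" "\<And>U. openin X U \<Longrightarrow> U \<subseteq> W \<Longrightarrow> U \<noteq> {} \<Longrightarrow> U \<inter> V \<noteq> {}"
  shows "nowhere_dense_in X (W - V)"
  unfolding nowhere_dense_in_def
proof
  show "W - V \<subseteq> topspace X"
    using openin_subset[OF assms(2)] by blast
  let ?I = "X interior_of (X closure_of (W - V))"
  have disjoint: "U \<inter> (W - V) \<noteq> {}" if "openin X U" "U \<subseteq> ?I" "U \<noteq> {}" for U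
    using that interior_of_subset[of X "X closure_of (W - V)"]
      openin_Int_closure_of_eq_empty[OF that(1), of "W - V"] by blast
  show "?I = {}"
  proof (rule ccontr)
    assume "?I \<noteq> {}"
    then have "?I \<inter> (W - V) \<noteq> {}"
      by (intro disjoint) auto
    then have "(?I \<inter> W) \<inter> V \<noteq> {}"
      using assms(2) by (intro assms(3)) auto
    then have "(?I \<inter> W \<inter> V) \<inter> (W - V) \<noteq> {}"
      using assms(1,2) by (intro disjoint openin_Int) auto
    then show False by blast
  qed
qed

lemma shift_invariant_openin_l_coset:
  assumes "shift_invariant G D" "x \<in> carrier G" "openin D U"
  shows "openin D (x <#\<^bsub>G\<^esub> U)"
  using assms unfolding shift_invariant_def by blast

text \<open>Conjugation need not preserve a right-invariant metric, so the convergence of the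
  conjugates of \<open>z m\<close> to the identity is drawn from the continuity of the group
  operations.\<close>

lemma topological_group_continuous_conjugation:
  assumes G: "topological_group G X" and u: "u \<in> carrier G"
  shows "continuous_map X X (\<lambda>x. inv\<^bsub>G\<^esub> u \<otimes>\<^bsub>G\<^esub> x \<otimes>\<^bsub>G\<^esub> u)"
proof -
  interpret group G using G by (simp add: topological_group_def)
  have top: "topspace X = carrier G"
    and mult: "continuous_map (prod_topology X X) X (\<lambda>(x, y). x \<otimes>\<^bsub>G\<^esub> y)"
    using G by (auto simp: topological_group_def)
  have mult': "continuous_map X X (\<lambda>x. f x \<otimes>\<^bsub>G\<^esub> g x)"
    if "continuous_map X X f" "continuous_map X X g" for f g
    using continuous_map_compose[OF continuous_map_pairedI[OF that] mult] by (simp add: o_def)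
  show ?thesis
    using u top by (intro mult') auto
qed

lemma left_kemperman_eventually_translate_meets:
  assumes M: "Metric_space (carrier G) d"
    and G: "topological_group G (Metric_space.mtopology (carrier G) d)"
    and D: "topspace D = carrier G" "shift_invariant G D" "left_kemperman G d D"
    and z: "\<And>n. z n \<in> carrier G" "limitin (Metric_space.mtopology (carrier G) d) z \<one>\<^bsub>G\<^esub> sequentially"
    and U: "openin D U" "U \<noteq> {}"
  shows "\<forall>\<^sub>F m in sequentially. \<exists>a\<in>U. z m \<otimes>\<^bsub>G\<^esub> a \<in> U"
proof -
  interpret group G using G by (simp add: topological_group_def)
  interpret Metric_space "carrier G" d by (fact M)
  obtain u where u: "u \<in> U" using U by blast
  have Usub: "U \<subseteq> carrier G" using openin_subset[OF U(1)] D(1) by simp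
  then have uG: "u \<in> carrier G" using u by blast
  let ?V = "inv\<^bsub>G\<^esub> u <#\<^bsub>G\<^esub> U"
  let ?c = "\<lambda>x. inv\<^bsub>G\<^esub> u \<otimes>\<^bsub>G\<^esub> x \<otimes>\<^bsub>G\<^esub> u"
  have "openin D ?V"
    using shift_invariant_openin_l_coset[OF D(2) _ U(1)] uG by simp
  moreover have "\<one>\<^bsub>G\<^esub> \<in> ?V"
    using u uG l_inv[OF uG] by (force simp: l_coset_def)
  ultimately obtain \<delta> where \<delta>: "\<delta> > 0"
      "\<And>t. t \<in> carrier G \<Longrightarrow> d \<one>\<^bsub>G\<^esub> t < \<delta> \<Longrightarrow> ?V \<inter> (t <#\<^bsub>G\<^esub> ?V) \<in> nonmeagre_baire_sets D"
    using D(3)[unfolded left_kemperman_def, rule_format, of ?V] by auto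
  have "limitin mtopology (?c \<circ> z) (?c \<one>\<^bsub>G\<^esub>) sequentially"
    by (rule continuous_map_limit[OF topological_group_continuous_conjugation[OF G uG] z(2)])
  then have "\<forall>\<^sub>F m in sequentially. d (?c (z m)) \<one>\<^bsub>G\<^esub> < \<delta>"
    using \<delta>(1) uG by (auto simp: limitin_metric elim: eventually_mono)
  then show ?thesis
  proof (rule eventually_mono)
    fix m assume "d (?c (z m)) \<one>\<^bsub>G\<^esub> < \<delta>"
    then have "?V \<inter> (?c (z m) <#\<^bsub>G\<^esub> ?V) \<noteq> {}"
      using \<delta>(2)[of "?c (z m)"] z(1)[of m] uG nonmeagre_imp_nonempty by (simp add: commute)
    \<comment> \<open>A common point has a representative in each coset. Cancelling \<open>u\<close>
      against its inverse inside the product, and then the leftmost inverse of \<open>u\<close>,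
      leaves \<open>b = z m \<otimes> a\<close>.\<close>
    then obtain a b where ab: "a \<in> U" "b \<in> U" "inv\<^bsub>G\<^esub> u \<otimes>\<^bsub>G\<^esub> b = ?c (z m) \<otimes>\<^bsub>G\<^esub> (inv\<^bsub>G\<^esub> u \<otimes>\<^bsub>G\<^esub> a)"
      unfolding l_coset_def by blast
    have G: "a \<in> carrier G" "b \<in> carrier G" using ab Usub by auto
    have "?c (z m) \<otimes>\<^bsub>G\<^esub> (inv\<^bsub>G\<^esub> u \<otimes>\<^bsub>G\<^esub> a)
        = inv\<^bsub>G\<^esub> u \<otimes>\<^bsub>G\<^esub> z m \<otimes>\<^bsub>G\<^esub> (u \<otimes>\<^bsub>G\<^esub> (inv\<^bsub>G\<^esub> u \<otimes>\<^bsub>G\<^esub> a))"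
      using G uG z(1)[of m] by (simp only: m_assoc inv_closed m_closed)
    also have "u \<otimes>\<^bsub>G\<^esub> (inv\<^bsub>G\<^esub> u \<otimes>\<^bsub>G\<^esub> a) = a"
      using G uG by (simp flip: m_assoc)
    also have "inv\<^bsub>G\<^esub> u \<otimes>\<^bsub>G\<^esub> z m \<otimes>\<^bsub>G\<^esub> a = inv\<^bsub>G\<^esub> u \<otimes>\<^bsub>G\<^esub> (z m \<otimes>\<^bsub>G\<^esub> a)"
      using G uG z(1)[of m] by (simp add: m_assoc)
    finally have "?c (z m) \<otimes>\<^bsub>G\<^esub> (inv\<^bsub>G\<^esub> u \<otimes>\<^bsub>G\<^esub> a) = inv\<^bsub>G\<^esub> u \<otimes>\<^bsub>G\<^esub> (z m \<otimes>\<^bsub>G\<^esub> a)" .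
    then have "b = z m \<otimes>\<^bsub>G\<^esub> a"
      using ab(3) G uG z(1)[of m] by simp
    then show "\<exists>a\<in>U. z m \<otimes>\<^bsub>G\<^esub> a \<in> U" using ab by blast
  qed
qed

theorem theorem5:
  fixes G :: "('a, 'b) monoid_scheme"
    and d :: "'a \<Rightarrow> 'a \<Rightarrow> real"
    and D :: "'a topology"
  defines "T \<equiv> Metric_space.mtopology (carrier G) d"
  assumes "Metric_space (carrier G) d"
    and "right_invariant G d"
    and "topological_group G T"
    and "separable_topology T"
    and "refines_topology D T"
    and "shift_invariant G D"
    and "localization_property D"
    and "left_kemperman G d D"
    and "strong_gandy_harrington T D"
  shows "\<forall>z :: nat \<Rightarrow> 'a. (\<forall>n. z n \<in> carrier G) \<and> limitin T z \<one>\<^bsub>G\<^esub> sequentially \<longrightarrow>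
    (\<forall>A\<in>nonmeagre_baire_sets D. \<exists>N\<in>meagre_sets D. \<forall>a\<in>A - N.
       \<exists>M :: nat set. infinite M \<and> {z m \<otimes>\<^bsub>G\<^esub> a | m. m \<in> M} \<subseteq> A)"
proof (intro allI impI ballI)
  fix z :: "nat \<Rightarrow> 'a" and A
  assume "(\<forall>n. z n \<in> carrier G) \<and> limitin T z \<one>\<^bsub>G\<^esub> sequentially"
  then have zG: "\<And>n. z n \<in> carrier G" and lim: "limitin T z \<one>\<^bsub>G\<^esub> sequentially"
    by auto
  assume A: "A \<in> nonmeagre_baire_sets D"
  interpret group G using assms(4) by (simp add: topological_group_def)
  have top: "topspace D = carrier G"
    using assms(4,6) by (simp add: topological_group_def refines_topology_def)
  define W where "W = D interior_of A"
  have W: "openin D W" "W \<subseteq> A" "W \<subseteq> carrier G"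
    using interior_of_subset[of D A] interior_of_subset_topspace[of D A] top
    by (auto simp: W_def)
  \<comment> \<open>The preimage of \<open>W\<close> under left multiplication by \<open>z m\<close>
    is a coset of \<open>W\<close>, hence open by shift-invariance.\<close>
  have mem_coset: "a \<in> inv\<^bsub>G\<^esub> (z m) <#\<^bsub>G\<^esub> W \<longleftrightarrow> z m \<otimes>\<^bsub>G\<^esub> a \<in> W" if "a \<in> carrier G" for a m
  proof
    assume "a \<in> inv\<^bsub>G\<^esub> (z m) <#\<^bsub>G\<^esub> W"
    then obtain h where "h \<in> W" "a = inv\<^bsub>G\<^esub> (z m) \<otimes>\<^bsub>G\<^esub> h"
      by (auto simp: l_coset_def)
    then show "z m \<otimes>\<^bsub>G\<^esub> a \<in> W"
      using W(3) zG[of m] that by (metis inv_solve_left subsetD)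
  next
    assume "z m \<otimes>\<^bsub>G\<^esub> a \<in> W"
    moreover have "a = inv\<^bsub>G\<^esub> (z m) \<otimes>\<^bsub>G\<^esub> (z m \<otimes>\<^bsub>G\<^esub> a)"
      using zG[of m] that by (simp add: inv_solve_left)
    ultimately show "a \<in> inv\<^bsub>G\<^esub> (z m) <#\<^bsub>G\<^esub> W"
      by (auto simp: l_coset_def)
  qed
  define V where "V k = (\<Union>m\<in>{k..}. inv\<^bsub>G\<^esub> (z m) <#\<^bsub>G\<^esub> W)" for k
  have nowhere_dense: "nowhere_dense_in D (W - V k)" for k
  proof (rule nowhere_dense_in_diff_open[OF _ W(1)])
    show "openin D (V k)"
      using shift_invariant_openin_l_coset[OF assms(7) _ W(1)] zG by (auto simp: V_def)
    fix U assume U: "openin D U" "U \<subseteq> W" "U \<noteq> {}"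
    have "\<forall>\<^sub>F m in sequentially. \<exists>a\<in>U. z m \<otimes>\<^bsub>G\<^esub> a \<in> U"
      by (rule left_kemperman_eventually_translate_meets[OF assms(2) assms(4)[unfolded T_def]
          top assms(7,9) zG lim[unfolded T_def] U(1,3)])
    \<comment> \<open>The index is taken beyond both \<open>k\<close> and the threshold for
      \<open>U\<close>. Since \<open>U \<subseteq> W\<close>, the point
      \<open>z m \<otimes> a\<close> lies in \<open>W\<close>, which puts \<open>a\<close> into
      \<open>V k\<close>.\<close>
    then obtain m a where "m \<ge> k" "a \<in> U" "z m \<otimes>\<^bsub>G\<^esub> a \<in> U"
      unfolding eventually_sequentially by (meson nat_le_linear)
    then show "U \<inter> V k \<noteq> {}"
      using U(2) W(3) mem_coset[of a m] by (auto simp: V_def)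
  qed
  have "A - W \<in> meagre_sets D"
    using assms(8) A by (simp add: localization_property_def nonmeagre_baire_sets_def W_def)
  then have meagre: "(A - W) \<union> (\<Union>k. W - V k) \<in> meagre_sets D"
    by (rule meagre_sets_Un_nowhere_dense) (rule nowhere_dense)
  show "\<exists>N\<in>meagre_sets D. \<forall>a\<in>A - N.
       \<exists>M :: nat set. infinite M \<and> {z m \<otimes>\<^bsub>G\<^esub> a | m. m \<in> M} \<subseteq> A"
  proof (intro bexI[OF _ meagre] ballI)
    fix a assume "a \<in> A - ((A - W) \<union> (\<Union>k. W - V k))"
    then have a: "a \<in> W" "\<And>k. a \<in> V k" by auto
    \<comment> \<open>Membership in every \<open>V k\<close> makes the set of good indices
      unbounded, hence infinite.\<close>
    have "\<exists>m\<ge>k. z m \<otimes>\<^bsub>G\<^esub> a \<in> W" for k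
      using a(2)[of k] mem_coset[of a] a(1) W(3) by (auto simp: V_def)
    then have "infinite {m. z m \<otimes>\<^bsub>G\<^esub> a \<in> W}"
      by (simp add: infinite_nat_iff_unbounded_le)
    then show "\<exists>M :: nat set. infinite M \<and> {z m \<otimes>\<^bsub>G\<^esub> a | m. m \<in> M} \<subseteq> A"
      using W(2) by (intro exI[of _ "{m. z m \<otimes>\<^bsub>G\<^esub> a \<in> W}"]) auto
  qed
qed

end
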